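(* Let $(\Gamma,v_0)$ be a pointed graph which produces a hypergroup $H(\Gamma)$, and let $P_k=(p_{k,i}^j)_{i,j\in I(\Gamma)}$, $k\in I(\Gamma)$, be the associated transition matrices. Suppose that (S1) for each $i\in I(\Gamma)$, the function $v\mapsto |S_i(v)|$ is constant on the vertex set $V$; and (S2) for all $i,j,k\in I(\Gamma)$, the function $v\mapsto |S_i(v)\cap S_j(v_0)|$ is constant on $S_k(v_0)$. Then for all $m\in\mathbb{N}$ and all $i,j,i_1,\ldots,i_m\in I(\Gamma)$, $$(P_{i_1}P_{i_2}\cdots P_{i_m})_{i,j}=\sum_{k\in I(\Gamma)}\tilde p_{i_1,i_2,\ldots,i_m}^{\,k}\,p_{k,i}^j.$$
   Context: Graphs: $\Gamma$ is a graph with vertex set $V$, $d$ is the shortest-path distance, $v_0\in V$ is a fixed base point, and $(\Gamma,v_0)$ is called a pointed graph. For $v\in V$ put $|v|=d(v_0,v)$. For $w\in V$ and $n\in\mathbb{N}_0=\{0,1,2,\dots\}$ put $S_n(w)=\{w'\in V: d(w,w')=n\}$. Put $I(\Gamma)=I(\Gamma,v_0)=\{n\in\mathbb{N}_0: |v|=n \text{ for some } v\in V\}$ and $M(\Gamma)=\sup I(\Gamma)$. $|A|$ denotes the cardinality of a set $A$. Standing assumptions on every graph: (i) simple, connected and locally finite; (ii) at most countably many vertices; (iii) if $\Gamma$ is finite, $S_{M(\Gamma)}(v)\neq\varnothing$ for every vertex $v$. (Consequently $S_j(v)\ne\varnothing$ for all $v\in V$, $j\in I(\Gamma)$.) Product: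 $H(\Gamma)=\{x_i\}_{i\in I(\Gamma)}$ is a set of formal symbols and $\mathbb{C}H(\Gamma)$ the free complex vector space on it. For $i,j,k\in I(\Gamma)$, $$p_{i,j}^k=\frac{1}{|S_i(v_0)|}\sum_{v\in S_i(v_0)}\frac{|S_j(v)\cap S_k(v_0)|}{|S_j(v)|},$$ and $\circ$ is the bilinear product on $\mathbb{C}H(\Gamma)$ with $x_i\circ x_j=\sum_{k\in I(\Gamma)}p_{i,j}^kx_k$ (a finite sum). The pointed graph produces a hypergroup when $(H(\Gamma),\circ,* )$ with $x_i^*=x_i$ is a discrete hermitian hypergroup; equivalently, when $\circ$ is associative and commutative, i.e. $\sum_{l\in I(\Gamma)}p_{h,i}^lp_{l,j}^k=\sum_{l\in I(\Gamma)}p_{i,j}^lp_{h,l}^k$ and $p_{i,j}^k=p_{j,i}^k$ for all $h,i,j,k\in I(\Gamma)$. The number $\tilde p_{i_1,\ldots,i_m}^{\,k}$ is the coefficient of $x_k$ in $$J(i_1,\ldots,i_m)=\sum_{v_1\in S_{i_1}(v_0)}\sum_{v_2\in S_{i_2}(v_1)}\cdots\sum_{v_m\in S_{i_m}(v_{m-1})}\frac{1}{\prod_{j=1}^m|S_{i_j}(v_{j-1})|}\,x_{|v_m|}.$$ In the matrix $P_k=(p_{k,i}^j)_{i,j\in I(\Gamma)}$, the $(i,j)$ entry is $p_{k,i}^j$. Matrix products are the usual ones (all sums involved are finite, since each row of each $P_k$ has finitely many nonzero entries). *)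

theory Defs
  imports
    "Graph_Theory.Pair_Digraph"
    "Graph_Theory.Digraph_Component"
    "HOL-Library.Poly_Mapping"
    "HOL-Library.Nonpos_Ints"
    "HOL-Library.Countable_Set"
begin

section \<open>Pointed graphs\<close>

definition walk_dist :: "'a pair_pre_digraph \<Rightarrow> 'a \<Rightarrow> 'a \<Rightarrow> nat" where
  "walk_dist G u w = (LEAST n. \<exists>p. pre_digraph.awalk (with_proj G) u p w \<and> length p = n)"

definition dsphere :: "'a pair_pre_digraph \<Rightarrow> nat \<Rightarrow> 'a \<Rightarrow> 'a set" where
  "dsphere G n w = {w' \<in> pverts G. walk_dist G w w' = n}"

definition levels :: "'a pair_pre_digraph \<Rightarrow> 'a \<Rightarrow> nat set" where
  "levels G v0 = {n. \<exists>v\<in>pverts G. walk_dist G v0 v = n}"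

text \<open>
  A simple undirected graph is a symmetric loop-free set of ordered pairs; no finiteness of the
  vertex set is implied. In \<open>sphere_nonempty\<close> the set of levels is finite and
  nonempty, so that \<open>Sup\<close> on \<open>nat\<close> is its maximum.
\<close>
locale pointed_graph = pair_bidirected_digraph G for G :: "'a pair_pre_digraph" +
  fixes v0 :: 'a
  assumes base: "v0 \<in> pverts G"
    and connected: "Digraph_Component.connected (with_proj G)"
    and locally_finite: "v \<in> pverts G \<Longrightarrow> finite {w. (v, w) \<in> parcs G}"
    and countable_verts: "countable (pverts G)"
    and sphere_nonempty:
      "finite (pverts G) \<Longrightarrow> v \<in> pverts G \<Longrightarrow> dsphere G (Sup (levels G v0)) v \<noteq> {}"


section \<open>Discrete hypergroups\<close>

definition free_vs :: "'x set \<Rightarrow> ('x \<Rightarrow>\<^sub>0 complex) set" where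
  "free_vs H = {f. Poly_Mapping.keys f \<subseteq> H}"

abbreviation scale :: "complex \<Rightarrow> ('x \<Rightarrow>\<^sub>0 complex) \<Rightarrow> ('x \<Rightarrow>\<^sub>0 complex)" where
  "scale c \<equiv> Poly_Mapping.map ((*) c)"

abbreviation basis :: "'x \<Rightarrow> ('x \<Rightarrow>\<^sub>0 complex)" where
  "basis x \<equiv> Poly_Mapping.single x 1"

text \<open>The conjugate-linear extension of a map between basis elements.\<close>
definition star_ext :: "('x \<Rightarrow> 'x) \<Rightarrow> ('x \<Rightarrow>\<^sub>0 complex) \<Rightarrow> ('x \<Rightarrow>\<^sub>0 complex)" where
  "star_ext star f = (\<Sum>x\<in>Poly_Mapping.keys f. Poly_Mapping.single (star x) (cnj (Poly_Mapping.lookup f x)))"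

text \<open>
  The free vector space on \<open>H\<close> is a unital associative \<open>*\<close>-algebra whose unit \<open>e\<close> is a basis
  element; products of basis elements are finitely supported probability vectors, and \<open>e\<close> lies
  in the support of \<open>x \<circ> y\<close> exactly when \<open>y = x\<^sup>*\<close>.
\<close>
locale discrete_hypergroup =
  fixes H :: "'x set"
    and e :: 'x
    and mul :: "('x \<Rightarrow>\<^sub>0 complex) \<Rightarrow> ('x \<Rightarrow>\<^sub>0 complex) \<Rightarrow> ('x \<Rightarrow>\<^sub>0 complex)"
    and star :: "'x \<Rightarrow> 'x"
  assumes unit_in: "e \<in> H"
    and mul_closed: "f \<in> free_vs H \<Longrightarrow> g \<in> free_vs H \<Longrightarrow> mul f g \<in> free_vs H"
    and mul_add_left: "f \<in> free_vs H \<Longrightarrow> g \<in> free_vs H \<Longrightarrow> h \<in> free_vs H \<Longrightarrow>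
      mul (f + g) h = mul f h + mul g h"
    and mul_add_right: "f \<in> free_vs H \<Longrightarrow> g \<in> free_vs H \<Longrightarrow> h \<in> free_vs H \<Longrightarrow>
      mul f (g + h) = mul f g + mul f h"
    and mul_scale_left: "f \<in> free_vs H \<Longrightarrow> g \<in> free_vs H \<Longrightarrow> mul (scale c f) g = scale c (mul f g)"
    and mul_scale_right: "f \<in> free_vs H \<Longrightarrow> g \<in> free_vs H \<Longrightarrow> mul f (scale c g) = scale c (mul f g)"
    and mul_assoc: "f \<in> free_vs H \<Longrightarrow> g \<in> free_vs H \<Longrightarrow> h \<in> free_vs H \<Longrightarrow>
      mul (mul f g) h = mul f (mul g h)"
    and unit_left: "f \<in> free_vs H \<Longrightarrow> mul (basis e) f = f"
    and unit_right: "f \<in> free_vs H \<Longrightarrow> mul f (basis e) = f"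
    and star_closed: "x \<in> H \<Longrightarrow> star x \<in> H"
    and star_star: "x \<in> H \<Longrightarrow> star (star x) = x"
    and star_mul: "f \<in> free_vs H \<Longrightarrow> g \<in> free_vs H \<Longrightarrow>
      star_ext star (mul f g) = mul (star_ext star g) (star_ext star f)"
    and coeff_nonneg: "x \<in> H \<Longrightarrow> y \<in> H \<Longrightarrow>
      Poly_Mapping.lookup (mul (basis x) (basis y)) z \<in> \<real>\<^sub>\<ge>\<^sub>0"
    and coeff_sum: "x \<in> H \<Longrightarrow> y \<in> H \<Longrightarrow>
      (\<Sum>z\<in>Poly_Mapping.keys (mul (basis x) (basis y)). Poly_Mapping.lookup (mul (basis x) (basis y)) z) = 1"
    and unit_in_support: "x \<in> H \<Longrightarrow> y \<in> H \<Longrightarrow>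
      e \<in> Poly_Mapping.keys (mul (basis x) (basis y)) \<longleftrightarrow> y = star x"

locale hermitian_discrete_hypergroup = discrete_hypergroup +
  assumes hermitian: "x \<in> H \<Longrightarrow> star x = x"


section \<open>The product of a pointed graph\<close>

text \<open>
  Below, \<open>sum' f A\<close> is the sum of a family \<open>f\<close> over a possibly infinite set \<open>A\<close>, finitely many
  members of which are nonzero. The number \<open>str_const G v0 i j k\<close> is $p_{i,j}^k$; it is
  typed as a complex number since it is a coefficient in $\mathbb{C}H(\Gamma)$. The symbol
  $x_i$ is encoded by its index \<open>i\<close>.
\<close>

definition str_const :: "'a pair_pre_digraph \<Rightarrow> 'a \<Rightarrow> nat \<Rightarrow> nat \<Rightarrow> nat \<Rightarrow> complex" where
  "str_const G v0 i j k =
     1 / of_nat (card (dsphere G i v0)) *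
     (\<Sum>v\<in>dsphere G i v0. of_nat (card (dsphere G j v \<inter> dsphere G k v0)) / of_nat (card (dsphere G j v)))"

definition graph_mul ::
  "'a pair_pre_digraph \<Rightarrow> 'a \<Rightarrow> (nat \<Rightarrow>\<^sub>0 complex) \<Rightarrow> (nat \<Rightarrow>\<^sub>0 complex) \<Rightarrow> (nat \<Rightarrow>\<^sub>0 complex)" where
  "graph_mul G v0 f g =
     (\<Sum>i\<in>Poly_Mapping.keys f. \<Sum>j\<in>Poly_Mapping.keys g.
        sum' (\<lambda>k. Poly_Mapping.single k
          (Poly_Mapping.lookup f i * Poly_Mapping.lookup g j * str_const G v0 i j k)) (levels G v0))"

definition produces_hypergroup :: "'a pair_pre_digraph \<Rightarrow> 'a \<Rightarrow> bool" where
  "produces_hypergroup G v0 \<longleftrightarrow>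
     hermitian_discrete_hypergroup (levels G v0) 0 (graph_mul G v0) (\<lambda>i. i)"


section \<open>Successive jumps and transition matrices\<close>

text \<open>
  \<open>jump_from G v0 u is c\<close> performs the nested summation over the vertices visited after \<open>u\<close>,
  where \<open>c\<close> is the product of the cardinalities of the spheres chosen from so far.
\<close>
primrec jump_from ::
  "'a pair_pre_digraph \<Rightarrow> 'a \<Rightarrow> 'a \<Rightarrow> nat list \<Rightarrow> nat \<Rightarrow> (nat \<Rightarrow>\<^sub>0 complex)" where
  "jump_from G v0 u [] c = Poly_Mapping.single (walk_dist G v0 u) (1 / of_nat c)"
| "jump_from G v0 u (i # ks) c =
     (\<Sum>v\<in>dsphere G i u. jump_from G v0 v ks (c * card (dsphere G i u)))"

definition jump :: "'a pair_pre_digraph \<Rightarrow> 'a \<Rightarrow> nat list \<Rightarrow> (nat \<Rightarrow>\<^sub>0 complex)" where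
  "jump G v0 ks = jump_from G v0 v0 ks 1"

definition jump_coeff :: "'a pair_pre_digraph \<Rightarrow> 'a \<Rightarrow> nat list \<Rightarrow> nat \<Rightarrow> complex" where
  "jump_coeff G v0 ks k = Poly_Mapping.lookup (jump G v0 ks) k"

definition trans_mat :: "'a pair_pre_digraph \<Rightarrow> 'a \<Rightarrow> nat \<Rightarrow> nat \<Rightarrow> nat \<Rightarrow> complex" where
  "trans_mat G v0 k = (\<lambda>i j. str_const G v0 k i j)"

definition mat_mul ::
  "'x set \<Rightarrow> ('x \<Rightarrow> 'x \<Rightarrow> complex) \<Rightarrow> ('x \<Rightarrow> 'x \<Rightarrow> complex) \<Rightarrow> ('x \<Rightarrow> 'x \<Rightarrow> complex)" where
  "mat_mul I A B = (\<lambda>i j. sum' (\<lambda>l. A i l * B l j) I)"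

text \<open>The product of a nonempty list of matrices indexed by \<open>I\<close>.\<close>
definition mat_prod :: "'x set \<Rightarrow> ('x \<Rightarrow> 'x \<Rightarrow> complex) list \<Rightarrow> ('x \<Rightarrow> 'x \<Rightarrow> complex)" where
  "mat_prod I As = foldl (mat_mul I) (hd As) (tl As)"


section \<open>Characterization of the graphs that produce hypergroups\<close>

context pointed_graph
begin

lemma ex_walk:
  assumes "u \<in> pverts G" "w \<in> pverts G" shows "\<exists>p. awalk u p w"
proof -
  have "u \<rightarrow>\<^sup>*\<^bsub>mk_symmetric (with_proj G)\<^esub> w"
    using connected assms unfolding Digraph_Component.connected_def strongly_connected_def
    by (simp add: mk_symmetric_def)
  then have "u \<rightarrow>\<^sup>*\<^bsub>with_proj G\<^esub> w"
    using reachable_mk_symmetric_eq pair_sym_arcs by blast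
  then show ?thesis by (simp add: reachable_awalk)
qed

lemma walk_dist_le: "awalk u p w \<Longrightarrow> walk_dist G u w \<le> length p"
  unfolding walk_dist_def by (rule Least_le) auto

lemma ex_geodesic:
  assumes "u \<in> pverts G" "w \<in> pverts G"
  shows "\<exists>p. awalk u p w \<and> length p = walk_dist G u w"
  unfolding walk_dist_def
  by (rule LeastI_ex) (use ex_walk[OF assms] in auto)

lemma awalk_rev: "awalk u p w \<Longrightarrow> \<exists>q. awalk w q u \<and> length q = length p"
proof (induction p arbitrary: u)
  case Nil then show ?case by (auto simp: awalk_Nil_iff)
next
  case (Cons e p)
  then obtain q where q: "awalk w q (snd e)" "length q = length p" and e: "e \<in> parcs G" "u = fst e"
    by (auto simp: awalk_Cons_iff)
  have "(snd e, fst e) \<in> parcs G"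
    using e arcs_symmetric by (metis prod.collapse)
  then have "awalk (snd e) [(snd e, fst e)] u"
    using e by (auto simp: awalk_simps)
  then have "awalk w (q @ [(snd e, fst e)]) u" using q by (rule_tac awalk_appendI)
  then show ?case using q by (intro exI[of _ "q @ [(snd e, fst e)]"]) auto
qed

lemma walk_dist_sym:
  assumes "u \<in> pverts G" "w \<in> pverts G" shows "walk_dist G u w = walk_dist G w u"
  by (metis assms awalk_rev ex_geodesic walk_dist_le le_antisym)

lemma walk_dist_eq_0:
  assumes "u \<in> pverts G" "w \<in> pverts G" shows "walk_dist G u w = 0 \<longleftrightarrow> u = w"
proof
  assume "walk_dist G u w = 0" then show "u = w"
    using ex_geodesic[OF assms] by (auto simp: awalk_Nil_iff)
next
  assume "u = w" then have "awalk u [] w" using assms by (auto simp: awalk_Nil_iff)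
  then show "walk_dist G u w = 0" using walk_dist_le[of u "[]" w] by simp
qed

lemma finite_walk_ball: "finite {w. \<exists>p. awalk u p w \<and> length p = n}"
proof (induction n arbitrary: u)
  case 0 show ?case by (rule finite_subset[of _ "{u}"]) (auto simp: awalk_Nil_iff)
next
  case (Suc n)
  show ?case
  proof (cases "u \<in> pverts G")
    case True
    have "{w. \<exists>p. awalk u p w \<and> length p = Suc n} \<subseteq>
      (\<Union>x\<in>{x. (u, x) \<in> parcs G}. {w. \<exists>p. awalk x p w \<and> length p = n})"
      by (auto simp: length_Suc_conv awalk_Cons_iff) blast
    then show ?thesis using Suc locally_finite[OF True] by (metis (no_types, lifting) finite_UN_I finite_subset)
  next
    case False then have "{w. \<exists>p. awalk u p w \<and> length p = Suc n} = {}"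
      using awalk_hd_in_verts by auto
    then show ?thesis by (metis finite.emptyI)
  qed
qed

lemma finite_dsphere: assumes "u \<in> pverts G" shows "finite (dsphere G n u)"
  by (rule finite_subset[OF _ finite_walk_ball[of u n]])
     (use ex_geodesic[OF assms] in \<open>auto simp: dsphere_def\<close>)

lemma dsphere_down:
  assumes u: "u \<in> pverts G" and ne: "dsphere G n u \<noteq> {}" and "j \<le> n"
  shows "dsphere G j u \<noteq> {}"
proof -
  obtain w where w: "w \<in> pverts G" "walk_dist G u w = n" using ne by (auto simp: dsphere_def)
  then obtain p where p: "awalk u p w" "length p = n" using ex_geodesic u by blast
  define x where "x = awlast u (take j p)"
  have "awalk u (take j p @ drop j p) w" using p by simp
  then have 1: "awalk u (take j p) x" and 2: "awalk x (drop j p) w"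
    unfolding awalk_append_iff x_def by auto
  have x: "x \<in> pverts G" using 1 awalk_last_in_verts by auto
  obtain q where q: "awalk u q x" "length q = walk_dist G u x" using ex_geodesic u x by blast
  have "awalk u (q @ drop j p) w" using q 2 by (rule_tac awalk_appendI)
  then have "n \<le> walk_dist G u x + (n - j)" using walk_dist_le[of u "q @ drop j p" w] w p q by simp
  moreover have "walk_dist G u x \<le> j" using walk_dist_le[OF 1] p \<open>j \<le> n\<close> by simp
  ultimately have "walk_dist G u x = j" using \<open>j \<le> n\<close> by simp
  then show ?thesis using x by (auto simp: dsphere_def)
qed

lemma dsphere_nonempty:
  assumes v: "v \<in> pverts G" and j: "j \<in> levels G v0"
  shows "dsphere G j v \<noteq> {}"
proof (cases "finite (pverts G)")
  case True
  have "levels G v0 = walk_dist G v0 ` pverts G" by (auto simp: levels_def)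
  then have "finite (levels G v0)" using True by simp
  then have "j \<le> Sup (levels G v0)" using j by (simp add: le_cSup_finite)
  then show ?thesis using dsphere_down[OF v sphere_nonempty[OF True v]] by blast
next
  case False
  show ?thesis
  proof
    assume e: "dsphere G j v = {}"
    have "pverts G \<subseteq> (\<Union>n<j. dsphere G n v)"
    proof
      fix w assume w: "w \<in> pverts G"
      then have "dsphere G (walk_dist G v w) v \<noteq> {}" by (auto simp: dsphere_def)
      then have "walk_dist G v w < j" using e dsphere_down[OF v] by (meson not_le)
      then show "w \<in> (\<Union>n<j. dsphere G n v)" using w by (auto simp: dsphere_def)
    qed
    moreover have "finite (\<Union>n<j. dsphere G n v)" using finite_dsphere[OF v] by auto
    ultimately show False using False finite_subset by blast
  qed
qed


lemma finite_dist_spheres: "finite (levels G v0 \<inter> walk_dist G v0 ` (\<Union>v\<in>dsphere G i v0. dsphere G j v))"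
proof -
  have "finite (dsphere G i v0)" using finite_dsphere[OF base] .
  moreover have "\<forall>v\<in>dsphere G i v0. finite (dsphere G j v)" using finite_dsphere by (auto simp: dsphere_def)
  ultimately show ?thesis by auto
qed

lemma str_const_support:
  "{k. str_const G v0 i j k \<noteq> 0} \<subseteq> levels G v0 \<inter> walk_dist G v0 ` (\<Union>v\<in>dsphere G i v0. dsphere G j v)"
proof
  fix k assume "k \<in> {k. str_const G v0 i j k \<noteq> 0}"
  then have "(\<Sum>v\<in>dsphere G i v0. of_nat (card (dsphere G j v \<inter> dsphere G k v0)) / of_nat (card (dsphere G j v))) \<noteq> (0::complex)"
    unfolding str_const_def by auto
  then obtain v where v: "v \<in> dsphere G i v0"
      "of_nat (card (dsphere G j v \<inter> dsphere G k v0)) / of_nat (card (dsphere G j v)) \<noteq> (0::complex)"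
    by (rule sum.not_neutral_contains_not_neutral)
  then have "dsphere G j v \<inter> dsphere G k v0 \<noteq> {}" by (metis card.empty div_0 of_nat_0)
  with v(1)
  show "k \<in> levels G v0 \<inter> walk_dist G v0 ` (\<Union>v\<in>dsphere G i v0. dsphere G j v)"
    by (auto simp: dsphere_def levels_def)
qed

lemma finite_str_const: "finite {k. str_const G v0 i j k \<noteq> 0}"
  using finite_subset[OF str_const_support finite_dist_spheres] .

lemma str_const_levels: "str_const G v0 i j k \<noteq> 0 \<Longrightarrow> k \<in> levels G v0"
  using str_const_support by blast

lemma str_const_nonneg: "str_const G v0 i j k \<in> \<real>\<^sub>\<ge>\<^sub>0"
proof -
  have "str_const G v0 i j k = complex_of_real (1 / of_nat (card (dsphere G i v0)) *
     (\<Sum>v\<in>dsphere G i v0. of_nat (card (dsphere G j v \<inter> dsphere G k v0)) / of_nat (card (dsphere G j v))))"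
    unfolding str_const_def by simp
  then show ?thesis by (simp only: nonneg_Reals_of_real_iff) (simp add: sum_nonneg)
qed

lemma cnj_str_const: "cnj (str_const G v0 i j k) = str_const G v0 i j k"
  unfolding str_const_def by simp

lemma card_dsphere_ne:
  assumes "v \<in> pverts G" "j \<in> levels G v0" shows "card (dsphere G j v) \<noteq> 0"
  using dsphere_nonempty[OF assms] finite_dsphere[OF assms(1)] by simp

lemma str_const_sum:
  assumes i: "i \<in> levels G v0" and j: "j \<in> levels G v0" and F: "finite F" "{k. str_const G v0 i j k \<noteq> 0} \<subseteq> F"
  shows "(\<Sum>k\<in>F. str_const G v0 i j k) = 1"
proof -
  define F' where "F' = F \<union> (levels G v0 \<inter> walk_dist G v0 ` (\<Union>v\<in>dsphere G i v0. dsphere G j v))"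
  have F': "finite F'" using F finite_dist_spheres unfolding F'_def by auto
  have "(\<Sum>k\<in>F. str_const G v0 i j k) = (\<Sum>k\<in>F'. str_const G v0 i j k)"
    by (rule sum.mono_neutral_left[OF F']) (use F in \<open>auto simp: F'_def\<close>)
  also have "\<dots> = 1 / of_nat (card (dsphere G i v0)) *
     (\<Sum>v\<in>dsphere G i v0. \<Sum>k\<in>F'. of_nat (card (dsphere G j v \<inter> dsphere G k v0)) / of_nat (card (dsphere G j v)))"
    unfolding str_const_def sum_distrib_left[symmetric] by (rule arg_cong[OF sum.swap])
  also have "\<dots> = 1 / of_nat (card (dsphere G i v0)) * (\<Sum>v\<in>dsphere G i v0. 1)"
  proof -
    have "(\<Sum>k\<in>F'. of_nat (card (dsphere G j v \<inter> dsphere G k v0)) / of_nat (card (dsphere G j v))) = (1::complex)"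
      if v: "v \<in> dsphere G i v0" for v
    proof -
      have vV: "v \<in> pverts G" using v by (auto simp: dsphere_def)
      have "(\<Sum>k\<in>F'. card (dsphere G j v \<inter> dsphere G k v0)) = card (\<Union>k\<in>F'. dsphere G j v \<inter> dsphere G k v0)"
        by (rule card_UN_disjoint[symmetric, OF F'])
          (use finite_dsphere[OF vV] in \<open>auto simp: dsphere_def\<close>)
      also have "(\<Union>k\<in>F'. dsphere G j v \<inter> dsphere G k v0) = dsphere G j v"
      proof
        show "dsphere G j v \<subseteq> (\<Union>k\<in>F'. dsphere G j v \<inter> dsphere G k v0)"
        proof
          fix w assume w: "w \<in> dsphere G j v"
          then have "w \<in> pverts G" by (simp add: dsphere_def)
          then have 1: "walk_dist G v0 w \<in> levels G v0" and 2: "w \<in> dsphere G (walk_dist G v0 w) v0"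
            by (auto simp: levels_def dsphere_def)
          have "walk_dist G v0 w \<in> F'" unfolding F'_def using 1 w v by blast
          then show "w \<in> (\<Union>k\<in>F'. dsphere G j v \<inter> dsphere G k v0)" using w 2 by blast
        qed
      qed blast
      finally have *: "(\<Sum>k\<in>F'. card (dsphere G j v \<inter> dsphere G k v0)) = card (dsphere G j v)" .
      show ?thesis
        using card_dsphere_ne[OF vV j] unfolding sum_divide_distrib[symmetric] of_nat_sum[symmetric] * by simp
    qed
    then show ?thesis by simp
  qed
  also have "\<dots> = 1" using card_dsphere_ne[OF base i] by simp
  finally show ?thesis .
qed

lemma zero_levels: "0 \<in> levels G v0"
  using base walk_dist_eq_0 by (auto simp: levels_def)

lemma dsphere_0: "v \<in> pverts G \<Longrightarrow> dsphere G 0 v = {v}"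
  using walk_dist_eq_0 by (auto simp: dsphere_def)

lemma dsphere_inter:
  "dsphere G i v0 \<inter> dsphere G k v0 = (if i = k then dsphere G i v0 else {})"
  by (auto simp: dsphere_def)

lemma str_const_unit_left:
  assumes "j \<in> levels G v0" shows "str_const G v0 0 j k = (if j = k then 1 else 0)"
proof -
  have "card (dsphere G j v0) \<noteq> 0" using card_dsphere_ne[OF base assms] .
  then show ?thesis unfolding str_const_def dsphere_0[OF base]
    by (cases "j = k") (simp_all add: dsphere_inter)
qed

lemma str_const_unit_right:
  assumes i: "i \<in> levels G v0" shows "str_const G v0 i 0 k = (if i = k then 1 else 0)"
proof -
  have "(\<Sum>v\<in>dsphere G i v0. of_nat (card (dsphere G 0 v \<inter> dsphere G k v0)) / of_nat (card (dsphere G 0 v)))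
    = (\<Sum>v\<in>dsphere G i v0. if i = k then 1 else (0::complex))"
  proof (rule sum.cong[OF refl])
    fix v assume "v \<in> dsphere G i v0"
    then have v: "v \<in> pverts G" "walk_dist G v0 v = i" by (simp_all add: dsphere_def)
    then have "{v} \<inter> dsphere G k v0 = (if i = k then {v} else {})"
      by (simp add: dsphere_def)
    then show "of_nat (card (dsphere G 0 v \<inter> dsphere G k v0)) / of_nat (card (dsphere G 0 v)) =
      (if i = k then 1 else (0::complex))" unfolding dsphere_0[OF v(1)] by simp
  qed
  then show ?thesis using card_dsphere_ne[OF base i] unfolding str_const_def by simp
qed

lemma str_const_unit_support:
  assumes i: "i \<in> levels G v0" and j: "j \<in> levels G v0"
  shows "str_const G v0 i j 0 \<noteq> 0 \<longleftrightarrow> j = i"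
proof -
  have "(\<Sum>v\<in>dsphere G i v0. of_nat (card (dsphere G j v \<inter> dsphere G 0 v0)) / of_nat (card (dsphere G j v))) =
     (\<Sum>v\<in>dsphere G i v0. (if j = i then 1 else 0) / (of_nat (card (dsphere G j v)) :: complex))"
  proof (rule sum.cong[OF refl])
    fix v assume "v \<in> dsphere G i v0"
    then have v: "v \<in> pverts G" "walk_dist G v0 v = i" by (simp_all add: dsphere_def)
    have "walk_dist G v v0 = i" using walk_dist_sym[OF v(1) base] v(2) by simp
    then have "dsphere G j v \<inter> {v0} = (if j = i then {v0} else {})"
      using base by (simp add: dsphere_def)
    then show "of_nat (card (dsphere G j v \<inter> dsphere G 0 v0)) / of_nat (card (dsphere G j v)) =
     (if j = i then 1 else 0) / (of_nat (card (dsphere G j v)) :: complex)"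
      unfolding dsphere_0[OF base] by simp
  qed
  then have "str_const G v0 i j 0 = complex_of_real (1 / of_nat (card (dsphere G i v0)) *
     (\<Sum>v\<in>dsphere G i v0. (if j = i then 1 else 0) / of_nat (card (dsphere G j v))))"
    unfolding str_const_def by (cases "j = i") simp_all
  note * = this
  have "(\<Sum>v\<in>dsphere G i v0. 1 / of_nat (card (dsphere G j v))) > (0::real)"
  proof (rule sum_pos)
    fix v assume "v \<in> dsphere G i v0"
    then have "v \<in> pverts G" by (simp add: dsphere_def)
    then show "1 / of_nat (card (dsphere G j v)) > (0::real)" using card_dsphere_ne[OF _ j] by simp
  qed (use finite_dsphere[OF base] dsphere_nonempty[OF base i] in simp_all)
  then show ?thesis unfolding * of_real_eq_0_iff using card_dsphere_ne[OF base i] by (cases "j = i") simp_all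
qed


lemma graph_mul_lookup:
  assumes A: "finite A" "Poly_Mapping.keys f \<subseteq> A" and B: "finite B" "Poly_Mapping.keys g \<subseteq> B"
  shows "Poly_Mapping.lookup (graph_mul G v0 f g) k =
    (\<Sum>i\<in>A. \<Sum>j\<in>B. Poly_Mapping.lookup f i * Poly_Mapping.lookup g j * str_const G v0 i j k)"
proof -
  have inner: "Poly_Mapping.lookup (sum' (\<lambda>k. Poly_Mapping.single k (a * str_const G v0 i j k)) (levels G v0)) k =
      a * str_const G v0 i j k" for i j a
  proof -
    let ?S = "{x \<in> levels G v0. Poly_Mapping.single x (a * str_const G v0 i j x) \<noteq> 0}"
    have fin: "finite ?S"
    proof (rule finite_subset[OF _ finite_str_const[of i j]])
      show "?S \<subseteq> {k. str_const G v0 i j k \<noteq> 0}" by auto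
    qed
    have "Poly_Mapping.lookup (sum' (\<lambda>k. Poly_Mapping.single k (a * str_const G v0 i j k)) (levels G v0)) k =
      (\<Sum>x\<in>?S. Poly_Mapping.lookup (Poly_Mapping.single x (a * str_const G v0 i j x)) k)"
      unfolding sum.G_def using fin by (simp add: lookup_sum)
    also have "\<dots> = (\<Sum>x\<in>?S. if x = k then a * str_const G v0 i j x else 0)"
      by (rule sum.cong[OF refl]) (simp add: lookup_single when_def)
    also have "\<dots> = (if k \<in> ?S then a * str_const G v0 i j k else 0)"
      using fin by (simp add: sum.delta')
    also have "\<dots> = a * str_const G v0 i j k"
    proof (cases "a * str_const G v0 i j k = 0")
      case False
      then have "Poly_Mapping.lookup (Poly_Mapping.single k (a * str_const G v0 i j k)) k \<noteq> 0" by simp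
      then have "Poly_Mapping.single k (a * str_const G v0 i j k) \<noteq> 0" by (metis lookup_zero)
      moreover have "k \<in> levels G v0" using False str_const_levels by fastforce
      ultimately show ?thesis by simp
    qed simp
    finally show ?thesis .
  qed
  have "Poly_Mapping.lookup (graph_mul G v0 f g) k =
    (\<Sum>i\<in>Poly_Mapping.keys f. \<Sum>j\<in>Poly_Mapping.keys g.
      Poly_Mapping.lookup f i * Poly_Mapping.lookup g j * str_const G v0 i j k)"
    unfolding graph_mul_def lookup_sum inner ..
  also have "\<dots> = (\<Sum>i\<in>Poly_Mapping.keys f. \<Sum>j\<in>B.
      Poly_Mapping.lookup f i * Poly_Mapping.lookup g j * str_const G v0 i j k)"
    by (rule sum.cong[OF refl], rule sum.mono_neutral_left[OF B]) (simp add: in_keys_iff)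
  also have "\<dots> = (\<Sum>i\<in>A. \<Sum>j\<in>B. Poly_Mapping.lookup f i * Poly_Mapping.lookup g j * str_const G v0 i j k)"
    by (rule sum.mono_neutral_left[OF A]) (simp add: in_keys_iff)
  finally show ?thesis .
qed

lemma graph_mul_basis:
  "Poly_Mapping.lookup (graph_mul G v0 (basis i) (basis j)) k = str_const G v0 i j k"
  using graph_mul_lookup[of "{i}" "basis i" "{j}" "basis j" k] by simp

lemma graph_mul_keys: "Poly_Mapping.keys (graph_mul G v0 f g) \<subseteq> levels G v0"
proof
  fix k assume "k \<in> Poly_Mapping.keys (graph_mul G v0 f g)"
  then have "(\<Sum>i\<in>Poly_Mapping.keys f. \<Sum>j\<in>Poly_Mapping.keys g.
      Poly_Mapping.lookup f i * Poly_Mapping.lookup g j * str_const G v0 i j k) \<noteq> 0"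
    unfolding in_keys_iff by (simp add: graph_mul_lookup[OF finite_keys order_refl finite_keys order_refl])
  then obtain i where "(\<Sum>j\<in>Poly_Mapping.keys g.
      Poly_Mapping.lookup f i * Poly_Mapping.lookup g j * str_const G v0 i j k) \<noteq> 0"
    by (rule sum.not_neutral_contains_not_neutral)
  then obtain j where "Poly_Mapping.lookup f i * Poly_Mapping.lookup g j * str_const G v0 i j k \<noteq> 0"
    by (rule sum.not_neutral_contains_not_neutral)
  then show "k \<in> levels G v0" using str_const_levels[of i j k] by simp
qed

lemma sum'_levels:
  fixes f :: "nat \<Rightarrow> complex"
  assumes "finite F" "{l. f l \<noteq> 0} \<subseteq> F" "\<And>l. f l \<noteq> 0 \<Longrightarrow> l \<in> levels G v0"
  shows "sum' f (levels G v0) = (\<Sum>l\<in>F. f l)"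
proof -
  have fin: "finite {l \<in> levels G v0. f l \<noteq> 0}" using assms(1,2) by (auto intro: finite_subset)
  then have "sum' f (levels G v0) = sum f {l \<in> levels G v0. f l \<noteq> 0}" by (simp add: sum.G_def)
  also have "\<dots> = sum f F"
  proof (rule sum.mono_neutral_left[OF assms(1)])
    show "{l \<in> levels G v0. f l \<noteq> 0} \<subseteq> F" using assms(2) by blast
    show "\<forall>i\<in>F - {l \<in> levels G v0. f l \<noteq> 0}. f i = 0" using assms(3) by blast
  qed
  finally show ?thesis .
qed

lemma assoc_left:
  fixes k :: nat
  assumes L: "finite L" "\<And>i j l. i \<in> Poly_Mapping.keys f \<Longrightarrow> j \<in> Poly_Mapping.keys g \<Longrightarrow> str_const G v0 i j l \<noteq> 0 \<Longrightarrow> l \<in> L"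
  shows "Poly_Mapping.lookup (graph_mul G v0 (graph_mul G v0 f g) h) k =
    (\<Sum>i\<in>Poly_Mapping.keys f. \<Sum>j\<in>Poly_Mapping.keys g. \<Sum>m\<in>Poly_Mapping.keys h.
       Poly_Mapping.lookup f i * Poly_Mapping.lookup g j * Poly_Mapping.lookup h m *
       sum' (\<lambda>l. str_const G v0 i j l * str_const G v0 l m k) (levels G v0))"
proof -
  let ?c = "str_const G v0"
  let ?f = "Poly_Mapping.lookup f" and ?g = "Poly_Mapping.lookup g" and ?h = "Poly_Mapping.lookup h"
  have sub: "Poly_Mapping.keys (graph_mul G v0 f g) \<subseteq> L"
  proof
    fix l assume "l \<in> Poly_Mapping.keys (graph_mul G v0 f g)"
    then have "(\<Sum>i\<in>Poly_Mapping.keys f. \<Sum>j\<in>Poly_Mapping.keys g. ?f i * ?g j * ?c i j l) \<noteq> 0"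
      unfolding in_keys_iff by (simp add: graph_mul_lookup[OF finite_keys order_refl finite_keys order_refl])
    then obtain i where i: "i \<in> Poly_Mapping.keys f" "(\<Sum>j\<in>Poly_Mapping.keys g. ?f i * ?g j * ?c i j l) \<noteq> 0"
      by (rule sum.not_neutral_contains_not_neutral)
    from i(2) obtain j where "j \<in> Poly_Mapping.keys g" "?f i * ?g j * ?c i j l \<noteq> 0"
      by (rule sum.not_neutral_contains_not_neutral)
    then show "l \<in> L" using L(2)[OF i(1)] by simp
  qed
  have "Poly_Mapping.lookup (graph_mul G v0 (graph_mul G v0 f g) h) k =
    (\<Sum>l\<in>L. \<Sum>m\<in>Poly_Mapping.keys h.
      (\<Sum>i\<in>Poly_Mapping.keys f. \<Sum>j\<in>Poly_Mapping.keys g. ?f i * ?g j * ?c i j l) * ?h m * ?c l m k)"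
    by (subst graph_mul_lookup[OF L(1) sub finite_keys order_refl])
       (simp only: graph_mul_lookup[OF finite_keys order_refl finite_keys order_refl])
  also have "\<dots> = (\<Sum>l\<in>L. \<Sum>m\<in>Poly_Mapping.keys h. \<Sum>i\<in>Poly_Mapping.keys f. \<Sum>j\<in>Poly_Mapping.keys g.
      ?f i * ?g j * ?h m * (?c i j l * ?c l m k))"
    by (simp add: sum_distrib_right sum_distrib_left mult_ac)
  also have "\<dots> = (\<Sum>l\<in>L. \<Sum>i\<in>Poly_Mapping.keys f. \<Sum>m\<in>Poly_Mapping.keys h. \<Sum>j\<in>Poly_Mapping.keys g.
      ?f i * ?g j * ?h m * (?c i j l * ?c l m k))"
    by (rule sum.cong[OF refl], rule sum.swap)
  also have "\<dots> = (\<Sum>l\<in>L. \<Sum>i\<in>Poly_Mapping.keys f. \<Sum>j\<in>Poly_Mapping.keys g. \<Sum>m\<in>Poly_Mapping.keys h.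
      ?f i * ?g j * ?h m * (?c i j l * ?c l m k))"
    by (rule sum.cong[OF refl], rule sum.cong[OF refl], rule sum.swap)
  also have "\<dots> = (\<Sum>i\<in>Poly_Mapping.keys f. \<Sum>l\<in>L. \<Sum>j\<in>Poly_Mapping.keys g. \<Sum>m\<in>Poly_Mapping.keys h.
      ?f i * ?g j * ?h m * (?c i j l * ?c l m k))"
    by (rule sum.swap)
  also have "\<dots> = (\<Sum>i\<in>Poly_Mapping.keys f. \<Sum>j\<in>Poly_Mapping.keys g. \<Sum>l\<in>L. \<Sum>m\<in>Poly_Mapping.keys h.
      ?f i * ?g j * ?h m * (?c i j l * ?c l m k))"
    by (rule sum.cong[OF refl], rule sum.swap)
  also have "\<dots> = (\<Sum>i\<in>Poly_Mapping.keys f. \<Sum>j\<in>Poly_Mapping.keys g. \<Sum>m\<in>Poly_Mapping.keys h. \<Sum>l\<in>L.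
      ?f i * ?g j * ?h m * (?c i j l * ?c l m k))"
    by (rule sum.cong[OF refl], rule sum.cong[OF refl], rule sum.swap)
  also have "\<dots> = (\<Sum>i\<in>Poly_Mapping.keys f. \<Sum>j\<in>Poly_Mapping.keys g. \<Sum>m\<in>Poly_Mapping.keys h.
      ?f i * ?g j * ?h m * sum' (\<lambda>l. ?c i j l * ?c l m k) (levels G v0))"
  proof (intro sum.cong refl)
    fix i j m assume ij: "i \<in> Poly_Mapping.keys f" "j \<in> Poly_Mapping.keys g"
    have "sum' (\<lambda>l. ?c i j l * ?c l m k) (levels G v0) = (\<Sum>l\<in>L. ?c i j l * ?c l m k)"
    proof (rule sum'_levels[OF L(1)])
      show "{l. ?c i j l * ?c l m k \<noteq> 0} \<subseteq> L" using L(2)[OF ij] by auto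
      show "l \<in> levels G v0" if "?c i j l * ?c l m k \<noteq> 0" for l using that str_const_levels[of i j l] by simp
    qed
    then show "(\<Sum>l\<in>L. ?f i * ?g j * ?h m * (?c i j l * ?c l m k)) =
      ?f i * ?g j * ?h m * sum' (\<lambda>l. ?c i j l * ?c l m k) (levels G v0)"
      by (simp add: sum_distrib_left)
  qed
  finally show ?thesis .
qed

lemma assoc_right:
  fixes k :: nat
  assumes L: "finite L" "\<And>i j l. i \<in> Poly_Mapping.keys g \<Longrightarrow> j \<in> Poly_Mapping.keys h \<Longrightarrow> str_const G v0 i j l \<noteq> 0 \<Longrightarrow> l \<in> L"
  shows "Poly_Mapping.lookup (graph_mul G v0 f (graph_mul G v0 g h)) k =
    (\<Sum>i\<in>Poly_Mapping.keys f. \<Sum>j\<in>Poly_Mapping.keys g. \<Sum>m\<in>Poly_Mapping.keys h.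
       Poly_Mapping.lookup f i * Poly_Mapping.lookup g j * Poly_Mapping.lookup h m *
       sum' (\<lambda>l. str_const G v0 j m l * str_const G v0 i l k) (levels G v0))"
proof -
  let ?c = "str_const G v0"
  let ?f = "Poly_Mapping.lookup f" and ?g = "Poly_Mapping.lookup g" and ?h = "Poly_Mapping.lookup h"
  have sub: "Poly_Mapping.keys (graph_mul G v0 g h) \<subseteq> L"
  proof
    fix l assume "l \<in> Poly_Mapping.keys (graph_mul G v0 g h)"
    then have "(\<Sum>i\<in>Poly_Mapping.keys g. \<Sum>j\<in>Poly_Mapping.keys h. ?g i * ?h j * ?c i j l) \<noteq> 0"
      unfolding in_keys_iff by (simp add: graph_mul_lookup[OF finite_keys order_refl finite_keys order_refl])
    then obtain i where i: "i \<in> Poly_Mapping.keys g" "(\<Sum>j\<in>Poly_Mapping.keys h. ?g i * ?h j * ?c i j l) \<noteq> 0"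
      by (rule sum.not_neutral_contains_not_neutral)
    from i(2) obtain j where "j \<in> Poly_Mapping.keys h" "?g i * ?h j * ?c i j l \<noteq> 0"
      by (rule sum.not_neutral_contains_not_neutral)
    then show "l \<in> L" using L(2)[OF i(1)] by simp
  qed
  have "Poly_Mapping.lookup (graph_mul G v0 f (graph_mul G v0 g h)) k =
    (\<Sum>i\<in>Poly_Mapping.keys f. \<Sum>l\<in>L.
      ?f i * (\<Sum>j\<in>Poly_Mapping.keys g. \<Sum>m\<in>Poly_Mapping.keys h. ?g j * ?h m * ?c j m l) * ?c i l k)"
    by (subst graph_mul_lookup[OF finite_keys order_refl L(1) sub])
       (simp only: graph_mul_lookup[OF finite_keys order_refl finite_keys order_refl])
  also have "\<dots> = (\<Sum>i\<in>Poly_Mapping.keys f. \<Sum>l\<in>L. \<Sum>j\<in>Poly_Mapping.keys g. \<Sum>m\<in>Poly_Mapping.keys h.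
      ?f i * ?g j * ?h m * (?c j m l * ?c i l k))"
    by (simp add: sum_distrib_right sum_distrib_left mult_ac)
  also have "\<dots> = (\<Sum>i\<in>Poly_Mapping.keys f. \<Sum>j\<in>Poly_Mapping.keys g. \<Sum>l\<in>L. \<Sum>m\<in>Poly_Mapping.keys h.
      ?f i * ?g j * ?h m * (?c j m l * ?c i l k))"
    by (rule sum.cong[OF refl], rule sum.swap)
  also have "\<dots> = (\<Sum>i\<in>Poly_Mapping.keys f. \<Sum>j\<in>Poly_Mapping.keys g. \<Sum>m\<in>Poly_Mapping.keys h. \<Sum>l\<in>L.
      ?f i * ?g j * ?h m * (?c j m l * ?c i l k))"
    by (rule sum.cong[OF refl], rule sum.cong[OF refl], rule sum.swap)
  also have "\<dots> = (\<Sum>i\<in>Poly_Mapping.keys f. \<Sum>j\<in>Poly_Mapping.keys g. \<Sum>m\<in>Poly_Mapping.keys h.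
      ?f i * ?g j * ?h m * sum' (\<lambda>l. ?c j m l * ?c i l k) (levels G v0))"
  proof (intro sum.cong refl)
    fix i j m assume jm: "j \<in> Poly_Mapping.keys g" "m \<in> Poly_Mapping.keys h"
    have "sum' (\<lambda>l. ?c j m l * ?c i l k) (levels G v0) = (\<Sum>l\<in>L. ?c j m l * ?c i l k)"
    proof (rule sum'_levels[OF L(1)])
      show "{l. ?c j m l * ?c i l k \<noteq> 0} \<subseteq> L" using L(2)[OF jm] by auto
      show "l \<in> levels G v0" if "?c j m l * ?c i l k \<noteq> 0" for l using that str_const_levels[of j m l] by simp
    qed
    then show "(\<Sum>l\<in>L. ?f i * ?g j * ?h m * (?c j m l * ?c i l k)) =
      ?f i * ?g j * ?h m * sum' (\<lambda>l. ?c j m l * ?c i l k) (levels G v0)"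
      by (simp add: sum_distrib_left)
  qed
  finally show ?thesis .
qed

lemma finite_joint_support:
  assumes "finite A" "finite B"
  shows "\<exists>L. finite L \<and> (\<forall>i\<in>A. \<forall>j\<in>B. \<forall>l. str_const G v0 i j l \<noteq> 0 \<longrightarrow> l \<in> L)"
  by (rule exI[of _ "\<Union>i\<in>A. \<Union>j\<in>B. {l. str_const G v0 i j l \<noteq> 0}"])
     (use assms finite_str_const in auto)

lemma star_ext_id: "Poly_Mapping.lookup (star_ext (\<lambda>i. i) f) k = cnj (Poly_Mapping.lookup f k)"
proof -
  have "Poly_Mapping.lookup (star_ext (\<lambda>i. i) f) k =
    (\<Sum>x\<in>Poly_Mapping.keys f. if x = k then cnj (Poly_Mapping.lookup f x) else 0)"
    unfolding star_ext_def lookup_sum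
    by (rule sum.cong[OF refl]) (simp add: lookup_single when_def)
  also have "\<dots> = cnj (Poly_Mapping.lookup f k)"
    by (simp add: sum.delta' in_keys_iff)
  finally show ?thesis .
qed

lemma keys_star_ext_id: "Poly_Mapping.keys (star_ext (\<lambda>i. i) f) = Poly_Mapping.keys f"
  by (auto simp: in_keys_iff star_ext_id)

text \<open>
  For the product of a pointed graph, all hypergroup axioms other than associativity and
  commutativity are automatic.
\<close>
theorem produces_hypergroup_iff:
  "produces_hypergroup G v0 \<longleftrightarrow>
    (\<forall>h\<in>levels G v0. \<forall>i\<in>levels G v0. \<forall>j\<in>levels G v0. \<forall>k\<in>levels G v0.
      sum' (\<lambda>l. str_const G v0 h i l * str_const G v0 l j k) (levels G v0) =
      sum' (\<lambda>l. str_const G v0 i j l * str_const G v0 h l k) (levels G v0)) \<and>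
    (\<forall>i\<in>levels G v0. \<forall>j\<in>levels G v0. \<forall>k\<in>levels G v0. str_const G v0 i j k = str_const G v0 j i k)"
  (is "?L \<longleftrightarrow> ?A \<and> ?C")
proof
  assume ?L
  then interpret hermitian_discrete_hypergroup "levels G v0" 0 "graph_mul G v0" "\<lambda>i. i"
    unfolding produces_hypergroup_def .
  have b: "basis i \<in> free_vs (levels G v0)" if "i \<in> levels G v0" for i
    using that by (simp add: free_vs_def)
  have ?A
  proof (intro ballI)
    fix h i j k assume I: "h \<in> levels G v0" "i \<in> levels G v0" "j \<in> levels G v0"
    obtain L where L: "finite L" "\<And>h' i' l. h' \<in> {h} \<Longrightarrow> i' \<in> {i} \<Longrightarrow> str_const G v0 h' i' l \<noteq> 0 \<Longrightarrow> l \<in> L"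
      using finite_joint_support[of "{h}" "{i}"] by auto
    obtain L' where L': "finite L'" "\<And>h' i' l. h' \<in> {i} \<Longrightarrow> i' \<in> {j} \<Longrightarrow> str_const G v0 h' i' l \<noteq> 0 \<Longrightarrow> l \<in> L'"
      using finite_joint_support[of "{i}" "{j}"] by auto
    show "sum' (\<lambda>l. str_const G v0 h i l * str_const G v0 l j k) (levels G v0) =
      sum' (\<lambda>l. str_const G v0 i j l * str_const G v0 h l k) (levels G v0)"
      using mul_assoc[OF b[OF I(1)] b[OF I(2)] b[OF I(3)]]
        assoc_left[of L "basis h" "basis i" "basis j" k] L
        assoc_right[of L' "basis i" "basis j" "basis h" k] L' by simp
  qed
  moreover have ?C
  proof (intro ballI)
    fix i j k assume I: "i \<in> levels G v0" "j \<in> levels G v0"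
    have e: "star_ext (\<lambda>i. i) (basis x) = basis x" for x :: nat
      by (simp add: star_ext_def)
    have "Poly_Mapping.lookup (star_ext (\<lambda>i. i) (graph_mul G v0 (basis i) (basis j))) k =
      Poly_Mapping.lookup (graph_mul G v0 (basis j) (basis i)) k"
      using star_mul[OF b[OF I(1)] b[OF I(2)]] by (simp add: e)
    then show "str_const G v0 i j k = str_const G v0 j i k"
      by (simp add: star_ext_id graph_mul_basis cnj_str_const)
  qed
  ultimately show "?A \<and> ?C" ..
next
  assume AC: "?A \<and> ?C"
  then have A: "sum' (\<lambda>l. str_const G v0 h i l * str_const G v0 l j k) (levels G v0) =
      sum' (\<lambda>l. str_const G v0 i j l * str_const G v0 h l k) (levels G v0)"
    if "h \<in> levels G v0" "i \<in> levels G v0" "j \<in> levels G v0" "k \<in> levels G v0" for h i j k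
    using that by blast
  have C: "str_const G v0 i j k = str_const G v0 j i k" if "i \<in> levels G v0" "j \<in> levels G v0" for i j k
  proof (cases "k \<in> levels G v0")
    case False
    then have "str_const G v0 i j k = 0" "str_const G v0 j i k = 0" using str_const_levels by blast+
    then show ?thesis by simp
  qed (use that AC in blast)
  let ?I = "levels G v0"
  have add_left: "graph_mul G v0 (f + g) h = graph_mul G v0 f h + graph_mul G v0 g h" for f g h
  proof (rule poly_mapping_eqI)
    fix k
    let ?K = "Poly_Mapping.keys f \<union> Poly_Mapping.keys g"
    have K: "finite ?K" "Poly_Mapping.keys (f + g) \<subseteq> ?K" "Poly_Mapping.keys f \<subseteq> ?K" "Poly_Mapping.keys g \<subseteq> ?K"
      using Poly_Mapping.keys_add[of f g] by auto
    show "Poly_Mapping.lookup (graph_mul G v0 (f + g) h) k = Poly_Mapping.lookup (graph_mul G v0 f h + graph_mul G v0 g h) k"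
      unfolding lookup_add
        graph_mul_lookup[OF K(1) K(2) finite_keys[of h] order_refl]
        graph_mul_lookup[OF K(1) K(3) finite_keys[of h] order_refl]
        graph_mul_lookup[OF K(1) K(4) finite_keys[of h] order_refl]
      by (simp add: distrib_right sum.distrib)
  qed
  have add_right: "graph_mul G v0 h (f + g) = graph_mul G v0 h f + graph_mul G v0 h g" for f g h
  proof (rule poly_mapping_eqI)
    fix k
    let ?K = "Poly_Mapping.keys f \<union> Poly_Mapping.keys g"
    have K: "finite ?K" "Poly_Mapping.keys (f + g) \<subseteq> ?K" "Poly_Mapping.keys f \<subseteq> ?K" "Poly_Mapping.keys g \<subseteq> ?K"
      using Poly_Mapping.keys_add[of f g] by auto
    show "Poly_Mapping.lookup (graph_mul G v0 h (f + g)) k = Poly_Mapping.lookup (graph_mul G v0 h f + graph_mul G v0 h g) k"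
      unfolding lookup_add
        graph_mul_lookup[OF finite_keys[of h] order_refl K(1) K(2)]
        graph_mul_lookup[OF finite_keys[of h] order_refl K(1) K(3)]
        graph_mul_lookup[OF finite_keys[of h] order_refl K(1) K(4)]
      by (simp add: distrib_left distrib_right sum.distrib)
  qed
  have scale_lookup: "Poly_Mapping.lookup (scale c f) x = c * Poly_Mapping.lookup f x" for c f and x :: nat
    by (simp add: Poly_Mapping.map.rep_eq when_def)
  have scale_keys: "Poly_Mapping.keys (scale c f) \<subseteq> Poly_Mapping.keys f" for c and f :: "nat \<Rightarrow>\<^sub>0 complex"
    by (auto simp: in_keys_iff scale_lookup)
  have scale_left: "graph_mul G v0 (scale c f) g = scale c (graph_mul G v0 f g)" for c f g
  proof (rule poly_mapping_eqI)
    show "Poly_Mapping.lookup (graph_mul G v0 (scale c f) g) k = Poly_Mapping.lookup (scale c (graph_mul G v0 f g)) k" for k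
      unfolding scale_lookup
        graph_mul_lookup[OF finite_keys[of f] scale_keys[of c f] finite_keys[of g] order_refl]
        graph_mul_lookup[OF finite_keys[of f] order_refl finite_keys[of g] order_refl]
      by (simp add: sum_distrib_left mult_ac)
  qed
  have scale_right: "graph_mul G v0 f (scale c g) = scale c (graph_mul G v0 f g)" for c f g
  proof (rule poly_mapping_eqI)
    show "Poly_Mapping.lookup (graph_mul G v0 f (scale c g)) k = Poly_Mapping.lookup (scale c (graph_mul G v0 f g)) k" for k
      unfolding scale_lookup
        graph_mul_lookup[OF finite_keys[of f] order_refl finite_keys[of g] scale_keys[of c g]]
        graph_mul_lookup[OF finite_keys[of f] order_refl finite_keys[of g] order_refl]
      by (simp add: sum_distrib_left mult_ac)
  qed
  have assoc: "graph_mul G v0 (graph_mul G v0 f g) h = graph_mul G v0 f (graph_mul G v0 g h)"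
    if fgh: "f \<in> free_vs ?I" "g \<in> free_vs ?I" "h \<in> free_vs ?I" for f g h
  proof (rule poly_mapping_eqI)
    fix k
    obtain L where L: "finite L" "\<And>i j l. i \<in> Poly_Mapping.keys f \<Longrightarrow> j \<in> Poly_Mapping.keys g \<Longrightarrow>
        str_const G v0 i j l \<noteq> 0 \<Longrightarrow> l \<in> L"
      using finite_joint_support[OF finite_keys[of f] finite_keys[of g]] by blast
    obtain L' where L': "finite L'" "\<And>i j l. i \<in> Poly_Mapping.keys g \<Longrightarrow> j \<in> Poly_Mapping.keys h \<Longrightarrow>
        str_const G v0 i j l \<noteq> 0 \<Longrightarrow> l \<in> L'"
      using finite_joint_support[OF finite_keys[of g] finite_keys[of h]] by blast
    show "Poly_Mapping.lookup (graph_mul G v0 (graph_mul G v0 f g) h) k =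
      Poly_Mapping.lookup (graph_mul G v0 f (graph_mul G v0 g h)) k"
    proof (cases "k \<in> ?I")
      case False
      then have "k \<notin> Poly_Mapping.keys (graph_mul G v0 (graph_mul G v0 f g) h)"
        "k \<notin> Poly_Mapping.keys (graph_mul G v0 f (graph_mul G v0 g h))" using graph_mul_keys by blast+
      then show ?thesis by (simp add: in_keys_iff)
    next
      case True
      show ?thesis
      proof (subst assoc_left[where L = L], goal_cases)
        case 1 show ?case by (rule L(1))
      next
        case 2 then show ?case by (rule L(2))
      next
        case 3
        show ?case
        proof (subst assoc_right[where L = L'], goal_cases)
          case 1 show ?case by (rule L'(1))
        next
          case 2 then show ?case by (rule L'(2))
        next
          case 3
          show ?case
          proof (intro sum.cong refl)
            fix i j m assume "i \<in> Poly_Mapping.keys f" "j \<in> Poly_Mapping.keys g" "m \<in> Poly_Mapping.keys h"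
            then have "i \<in> ?I" "j \<in> ?I" "m \<in> ?I" using fgh by (auto simp: free_vs_def)
            then show "Poly_Mapping.lookup f i * Poly_Mapping.lookup g j * Poly_Mapping.lookup h m *
                sum' (\<lambda>l. str_const G v0 i j l * str_const G v0 l m k) ?I =
              Poly_Mapping.lookup f i * Poly_Mapping.lookup g j * Poly_Mapping.lookup h m *
                sum' (\<lambda>l. str_const G v0 j m l * str_const G v0 i l k) ?I"
              using A True by simp
          qed
        qed
      qed
    qed
  qed
  have star: "star_ext (\<lambda>i. i) (graph_mul G v0 f g) = graph_mul G v0 (star_ext (\<lambda>i. i) g) (star_ext (\<lambda>i. i) f)"
    if fg: "f \<in> free_vs ?I" "g \<in> free_vs ?I" for f g
  proof (rule poly_mapping_eqI)
    fix k
    have "Poly_Mapping.lookup (graph_mul G v0 (star_ext (\<lambda>i. i) g) (star_ext (\<lambda>i. i) f)) k =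
      (\<Sum>j\<in>Poly_Mapping.keys g. \<Sum>i\<in>Poly_Mapping.keys f.
        cnj (Poly_Mapping.lookup g j) * cnj (Poly_Mapping.lookup f i) * str_const G v0 j i k)"
      by (subst graph_mul_lookup[of "Poly_Mapping.keys g" _ "Poly_Mapping.keys f"])
         (simp_all add: keys_star_ext_id star_ext_id)
    also have "\<dots> = (\<Sum>i\<in>Poly_Mapping.keys f. \<Sum>j\<in>Poly_Mapping.keys g.
        cnj (Poly_Mapping.lookup g j) * cnj (Poly_Mapping.lookup f i) * str_const G v0 j i k)"
      by (rule sum.swap)
    also have "\<dots> = (\<Sum>i\<in>Poly_Mapping.keys f. \<Sum>j\<in>Poly_Mapping.keys g.
        cnj (Poly_Mapping.lookup f i * Poly_Mapping.lookup g j * str_const G v0 i j k))"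
    proof (intro sum.cong refl)
      fix i j assume "i \<in> Poly_Mapping.keys f" "j \<in> Poly_Mapping.keys g"
      then have "i \<in> ?I" "j \<in> ?I" using fg by (auto simp: free_vs_def)
      then show "cnj (Poly_Mapping.lookup g j) * cnj (Poly_Mapping.lookup f i) * str_const G v0 j i k =
        cnj (Poly_Mapping.lookup f i * Poly_Mapping.lookup g j * str_const G v0 i j k)"
        using C[of i j k] by (simp add: cnj_str_const)
    qed
    also have "\<dots> = Poly_Mapping.lookup (star_ext (\<lambda>i. i) (graph_mul G v0 f g)) k"
      unfolding star_ext_id graph_mul_lookup[OF finite_keys order_refl finite_keys order_refl] by simp
    finally show "Poly_Mapping.lookup (star_ext (\<lambda>i. i) (graph_mul G v0 f g)) k =
      Poly_Mapping.lookup (graph_mul G v0 (star_ext (\<lambda>i. i) g) (star_ext (\<lambda>i. i) f)) k" ..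
  qed
  have unit_left: "graph_mul G v0 (basis 0) f = f" if f: "f \<in> free_vs ?I" for f
  proof (rule poly_mapping_eqI)
    fix k
    have "Poly_Mapping.lookup (graph_mul G v0 (basis 0) f) k =
      (\<Sum>j\<in>Poly_Mapping.keys f. Poly_Mapping.lookup f j * str_const G v0 0 j k)"
      using graph_mul_lookup[of "{0}" "basis 0" "Poly_Mapping.keys f" f k] by simp
    also have "\<dots> = (\<Sum>j\<in>Poly_Mapping.keys f. if j = k then Poly_Mapping.lookup f j else 0)"
    proof (rule sum.cong[OF refl])
      fix j assume "j \<in> Poly_Mapping.keys f"
      then have "j \<in> ?I" using f by (auto simp: free_vs_def)
      then show "Poly_Mapping.lookup f j * str_const G v0 0 j k = (if j = k then Poly_Mapping.lookup f j else 0)"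
        by (simp add: str_const_unit_left)
    qed
    also have "\<dots> = Poly_Mapping.lookup f k" by (simp add: sum.delta' in_keys_iff)
    finally show "Poly_Mapping.lookup (graph_mul G v0 (basis 0) f) k = Poly_Mapping.lookup f k" .
  qed
  have unit_right: "graph_mul G v0 f (basis 0) = f" if f: "f \<in> free_vs ?I" for f
  proof (rule poly_mapping_eqI)
    fix k
    have "Poly_Mapping.lookup (graph_mul G v0 f (basis 0)) k =
      (\<Sum>j\<in>Poly_Mapping.keys f. Poly_Mapping.lookup f j * str_const G v0 j 0 k)"
      using graph_mul_lookup[of "Poly_Mapping.keys f" f "{0}" "basis 0" k] by simp
    also have "\<dots> = (\<Sum>j\<in>Poly_Mapping.keys f. if j = k then Poly_Mapping.lookup f j else 0)"
    proof (rule sum.cong[OF refl])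
      fix j assume "j \<in> Poly_Mapping.keys f"
      then have "j \<in> ?I" using f by (auto simp: free_vs_def)
      then show "Poly_Mapping.lookup f j * str_const G v0 j 0 k = (if j = k then Poly_Mapping.lookup f j else 0)"
        by (simp add: str_const_unit_right)
    qed
    also have "\<dots> = Poly_Mapping.lookup f k" by (simp add: sum.delta' in_keys_iff)
    finally show "Poly_Mapping.lookup (graph_mul G v0 f (basis 0)) k = Poly_Mapping.lookup f k" .
  qed
  show ?L
    unfolding produces_hypergroup_def
  proof (unfold_locales, goal_cases)
    case 1 show ?case by (rule zero_levels)
  next
    case 2 show ?case unfolding free_vs_def using graph_mul_keys by blast
  next
    case 3 show ?case by (rule add_left)
  next
    case 4 show ?case by (rule add_right)
  next
    case 5 show ?case by (rule scale_left)
  next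
    case 6 show ?case by (rule scale_right)
  next
    case 7 then show ?case by (rule assoc)
  next
    case 8 then show ?case by (rule unit_left)
  next
    case 9 then show ?case by (rule unit_right)
  next
    case 10 then show ?case .
  next
    case 11 show ?case ..
  next
    case 12 then show ?case by (rule star)
  next
    case 13 show ?case unfolding graph_mul_basis by (rule str_const_nonneg)
  next
    case (14 x y)
    then show ?case unfolding graph_mul_basis
      by (intro str_const_sum) (auto simp: in_keys_iff graph_mul_basis)
  next
    case (15 x y) then show ?case unfolding in_keys_iff graph_mul_basis by (rule str_const_unit_support)
  qed
qed

end

end

theory Submission
  imports Defs
begin

text \<open>
  Right multiplication by $x_k$ acts on row vectors as $P_k$ by commutativity, so row \<open>i\<close> of
  $P_{i_1}\cdots P_{i_m}$ consists of the coefficients of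
  $(\cdots(x_i\circ x_{i_1})\circ\cdots)\circ x_{i_m} = x_i\circ(x_{i_1}\circ\cdots\circ x_{i_m})$.
  On the other hand (S1) and (S2) say that a jump to $S_n(u)$ lands in $S_k(v_0)$ with
  probability $p_{|u|,n}^k$ for every single vertex $u$, not only on average over its sphere.
  Successive jumps from $v_0$ are therefore a Markov chain on the levels, whose distribution
  $J(i_1,\ldots,i_m)$ is $x_{i_1}\circ\cdots\circ x_{i_m}$.
\<close>

lemma lookup_scale: "Poly_Mapping.lookup (scale c f) x = c * Poly_Mapping.lookup f x"
  by (simp add: Poly_Mapping.map.rep_eq when_def)

lemma scale_scale: "scale a (scale b f) = scale (a * b) f"
  by (rule poly_mapping_eqI) (simp add: lookup_scale)

lemma scale_sum: "scale a (\<Sum>v\<in>A. f v) = (\<Sum>v\<in>A. scale a (f v))"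
  by (rule poly_mapping_eqI) (simp add: lookup_scale lookup_sum sum_distrib_left)

lemma basis_in_free_vs: "x \<in> H \<Longrightarrow> basis x \<in> free_vs H"
  by (simp add: free_vs_def)

lemma scale_in_free_vs: "f \<in> free_vs H \<Longrightarrow> scale c f \<in> free_vs H"
  by (auto simp: free_vs_def in_keys_iff lookup_scale subset_iff)

lemma sum_in_free_vs: "(\<And>v. v \<in> A \<Longrightarrow> f v \<in> free_vs H) \<Longrightarrow> (\<Sum>v\<in>A. f v) \<in> free_vs H"
  unfolding free_vs_def by (fastforce dest: subsetD[OF keys_sum])

context discrete_hypergroup
begin

text \<open>Additivity applied to \<open>0 + 0\<close> gives
  \<open>mul 0 g = mul 0 g + mul 0 g\<close>, and one summand cancels.\<close>

lemma mul_zero_left: "g \<in> free_vs H \<Longrightarrow> mul 0 g = 0"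
  using mul_add_left[of 0 0 g] by (simp add: free_vs_def)

text \<open>Over an infinite index set both sums are 0 by convention, so that case reduces to
  \<open>mul_zero_left\<close>, like the empty one.\<close>

lemma mul_sum_left:
  assumes "g \<in> free_vs H" "\<And>v. v \<in> A \<Longrightarrow> f v \<in> free_vs H"
  shows "mul (\<Sum>v\<in>A. f v) g = (\<Sum>v\<in>A. mul (f v) g)"
  using assms(2)
proof (induction A rule: infinite_finite_induct)
  case (insert v A)
  then show ?case by (simp add: mul_add_left assms(1) sum_in_free_vs)
qed (simp_all add: mul_zero_left assms(1))

text \<open>Nested to the right because \<open>jump_from\<close> splits off the first jump; the
  final unit gives the empty list a value.\<close>

definition basis_prod :: "'x list \<Rightarrow> ('x \<Rightarrow>\<^sub>0 complex)" where
  "basis_prod ks = foldr (\<lambda>k. mul (basis k)) ks (basis e)"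

lemma basis_prod_Nil: "basis_prod [] = basis e"
  and basis_prod_Cons: "basis_prod (k # ks) = mul (basis k) (basis_prod ks)"
  by (simp_all add: basis_prod_def)

lemma basis_prod_closed: "set ks \<subseteq> H \<Longrightarrow> basis_prod ks \<in> free_vs H"
  by (induction ks) (simp_all add: basis_prod_Nil basis_prod_Cons basis_in_free_vs mul_closed unit_in)

text \<open>Associativity reconciles the left nesting of the matrix product with the right nesting
  of \<open>basis_prod\<close>.\<close>

lemma foldl_mul_basis:
  "f \<in> free_vs H \<Longrightarrow> set ks \<subseteq> H \<Longrightarrow>
    foldl (\<lambda>g k. mul g (basis k)) f ks = mul f (basis_prod ks)"
  by (induction ks arbitrary: f)
     (simp_all add: basis_prod_Nil basis_prod_Cons unit_right mul_closed mul_assoc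
       basis_in_free_vs basis_prod_closed)

end

context pointed_graph
begin

lemma walk_dist_in_levels: "u \<in> pverts G \<Longrightarrow> walk_dist G v0 u \<in> levels G v0"
  by (auto simp: levels_def)

text \<open>The characterization yields this for levels \<open>k\<close>; for any other
  \<open>k\<close> both sides vanish.\<close>

lemma str_const_commute:
  assumes "produces_hypergroup G v0" "i \<in> levels G v0" "j \<in> levels G v0"
  shows "str_const G v0 i j k = str_const G v0 j i k"
  using assms produces_hypergroup_iff str_const_levels by metis

lemma sum'_lookup_str_const:
  assumes "f \<in> free_vs (levels G v0)"
  shows "sum' (\<lambda>l. Poly_Mapping.lookup f l * str_const G v0 k l j) (levels G v0) =
    (\<Sum>l\<in>Poly_Mapping.keys f. Poly_Mapping.lookup f l * str_const G v0 k l j)"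
  by (rule sum'_levels) (use assms in \<open>auto simp: free_vs_def in_keys_iff\<close>)

lemma lookup_graph_mul_basis_left:
  assumes "f \<in> free_vs (levels G v0)"
  shows "Poly_Mapping.lookup (graph_mul G v0 (basis k) f) j =
    sum' (\<lambda>l. Poly_Mapping.lookup f l * str_const G v0 k l j) (levels G v0)"
  using graph_mul_lookup[of "{k}" "basis k" "Poly_Mapping.keys f" f j]
  by (simp add: sum'_lookup_str_const[OF assms])

text \<open>Expanding the product produces $p_{l,k}^j$; commutativity turns it into $p_{k,l}^j$, the
  $(l,j)$ entry of $P_k$.\<close>

lemma lookup_graph_mul_basis_right:
  assumes "produces_hypergroup G v0" "f \<in> free_vs (levels G v0)" "k \<in> levels G v0"
  shows "Poly_Mapping.lookup (graph_mul G v0 f (basis k)) j =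
    sum' (\<lambda>l. Poly_Mapping.lookup f l * str_const G v0 k l j) (levels G v0)"
proof -
  have "Poly_Mapping.lookup (graph_mul G v0 f (basis k)) j =
      (\<Sum>l\<in>Poly_Mapping.keys f. Poly_Mapping.lookup f l * str_const G v0 l k j)"
    using graph_mul_lookup[of "Poly_Mapping.keys f" f "{k}" "basis k" j] by simp
  also have "\<dots> = (\<Sum>l\<in>Poly_Mapping.keys f. Poly_Mapping.lookup f l * str_const G v0 k l j)"
    using assms by (intro sum.cong refl) (auto simp: free_vs_def intro!: str_const_commute)
  finally show ?thesis by (simp add: sum'_lookup_str_const[OF assms(2)])
qed

text \<open>Row \<open>i\<close> of a matrix product depends only on row \<open>i\<close> of the
  left factor, so the induction can follow that row alone, stored as the vector
  \<open>f\<close>.\<close>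

lemma foldl_mat_mul_row:
  assumes "produces_hypergroup G v0" "set ks \<subseteq> levels G v0"
    and "f \<in> free_vs (levels G v0)" "\<And>l. A i l = Poly_Mapping.lookup f l"
  shows "foldl (mat_mul (levels G v0)) A (map (trans_mat G v0) ks) i j =
    Poly_Mapping.lookup (foldl (\<lambda>g k. graph_mul G v0 g (basis k)) f ks) j"
  using assms(2-)
proof (induction ks arbitrary: A f)
  case (Cons k ks)
  have "graph_mul G v0 f (basis k) \<in> free_vs (levels G v0)"
    using graph_mul_keys by (simp add: free_vs_def)
  moreover have "mat_mul (levels G v0) A (trans_mat G v0 k) i l =
      Poly_Mapping.lookup (graph_mul G v0 f (basis k)) l" for l
    using Cons.prems assms(1) by (simp add: mat_mul_def trans_mat_def lookup_graph_mul_basis_right)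
  ultimately show ?case using Cons.IH Cons.prems(1) by simp
qed simp

text \<open>$p_{c,n}^k$ is an average over the sphere of radius $c = |u|$. (S1) makes the
  denominators of its terms equal and (S2) the numerators, so the average is its term at
  \<open>u\<close>.\<close>

lemma str_const_eq_ratio:
  assumes S1: "\<forall>n\<in>levels G v0. \<forall>u\<in>pverts G. \<forall>v\<in>pverts G.
      card (dsphere G n u) = card (dsphere G n v)"
    and S2: "\<forall>a\<in>levels G v0. \<forall>b\<in>levels G v0. \<forall>c\<in>levels G v0.
      \<forall>u\<in>dsphere G c v0. \<forall>v\<in>dsphere G c v0.
      card (dsphere G a u \<inter> dsphere G b v0) = card (dsphere G a v \<inter> dsphere G b v0)"
    and u: "u \<in> pverts G" and n: "n \<in> levels G v0"
  shows "str_const G v0 (walk_dist G v0 u) n k =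
    of_nat (card (dsphere G n u \<inter> dsphere G k v0)) / of_nat (card (dsphere G n u))"
proof (cases "k \<in> levels G v0")
  case True
  let ?c = "walk_dist G v0 u"
  have c: "?c \<in> levels G v0" using u by (rule walk_dist_in_levels)
  have uc: "u \<in> dsphere G ?c v0" using u by (simp add: dsphere_def)
  have "of_nat (card (dsphere G n v \<inter> dsphere G k v0)) / of_nat (card (dsphere G n v)) =
      (of_nat (card (dsphere G n u \<inter> dsphere G k v0)) / of_nat (card (dsphere G n u)) :: complex)"
    if v: "v \<in> dsphere G ?c v0" for v
  proof -
    have "v \<in> pverts G" using v by (simp add: dsphere_def)
    then have "card (dsphere G n v) = card (dsphere G n u)" using S1 n u by blast
    moreover have "card (dsphere G n v \<inter> dsphere G k v0) = card (dsphere G n u \<inter> dsphere G k v0)"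
      using S2 n True c v uc by blast
    ultimately show ?thesis by simp
  qed
  then show ?thesis using card_dsphere_ne[OF base c] by (simp add: str_const_def)
next
  \<comment> \<open>Here (S2) says nothing, but no vertex has distance \<open>k\<close> from
    \<open>v0\<close>, so both sides are 0.\<close>
  case False
  then have "dsphere G k v0 = {}" by (auto simp: dsphere_def levels_def)
  then show ?thesis using False str_const_levels by auto
qed

text \<open>Markov property: the result depends on \<open>u\<close> only through its level. Both
  \<open>u\<close> and \<open>c\<close> vary in the induction, since each jump moves the vertex and
  enlarges the accumulated denominator.\<close>

lemma jump_from_eq:
  assumes hyp: "produces_hypergroup G v0"
    and S1: "\<forall>n\<in>levels G v0. \<forall>u\<in>pverts G. \<forall>v\<in>pverts G.
      card (dsphere G n u) = card (dsphere G n v)"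
    and S2: "\<forall>a\<in>levels G v0. \<forall>b\<in>levels G v0. \<forall>c\<in>levels G v0.
      \<forall>u\<in>dsphere G c v0. \<forall>v\<in>dsphere G c v0.
      card (dsphere G a u \<inter> dsphere G b v0) = card (dsphere G a v \<inter> dsphere G b v0)"
    and "u \<in> pverts G" "set ks \<subseteq> levels G v0"
  shows "jump_from G v0 u ks c = scale (1 / of_nat c) (graph_mul G v0 (basis (walk_dist G v0 u))
    (discrete_hypergroup.basis_prod 0 (graph_mul G v0) ks))"
proof -
  interpret hermitian_discrete_hypergroup "levels G v0" 0 "graph_mul G v0" "\<lambda>i. i"
    using hyp unfolding produces_hypergroup_def .
  show ?thesis
    using assms(4-)
  proof (induction ks arbitrary: u c)
    case Nil
    have "scale (1 / of_nat c) (basis (walk_dist G v0 u)) =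
        Poly_Mapping.single (walk_dist G v0 u) (1 / of_nat c)"
      by (rule poly_mapping_eqI) (simp add: lookup_scale lookup_single when_def)
    then show ?case
      unfolding basis_prod_Nil
        unit_right[OF basis_in_free_vs[OF walk_dist_in_levels[OF Nil.prems(1)]]]
      by simp
  next
    case (Cons n ks)
    let ?d = "walk_dist G v0" and ?S = "dsphere G n u"
    let ?r = "1 / of_nat (card ?S) :: complex"
    have u: "u \<in> pverts G" and n: "n \<in> levels G v0" and ks: "set ks \<subseteq> levels G v0"
      using Cons.prems by auto
    have V: "v \<in> pverts G" if "v \<in> ?S" for v using that by (simp add: dsphere_def)
    have b: "basis (?d v) \<in> free_vs (levels G v0)" if "v \<in> pverts G" for v
      using that by (simp add: basis_in_free_vs walk_dist_in_levels)
    note Q = basis_prod_closed[OF ks]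
    \<comment> \<open>A single jump: the coefficient of $x_k$ on the left is the fraction of the
      sphere around \<open>u\<close> lying at level \<open>k\<close>.\<close>
    have step: "(\<Sum>v\<in>?S. scale ?r (basis (?d v))) = graph_mul G v0 (basis (?d u)) (basis n)"
    proof (rule poly_mapping_eqI)
      fix k
      have S: "{v \<in> ?S. ?d v = k} = ?S \<inter> dsphere G k v0" by (auto simp: dsphere_def)
      have "Poly_Mapping.lookup (\<Sum>v\<in>?S. scale ?r (basis (?d v))) k =
          (\<Sum>v\<in>?S. if ?d v = k then ?r else 0)"
        unfolding lookup_sum
        by (intro sum.cong refl) (simp add: lookup_scale lookup_single when_def)
      also have "\<dots> = (\<Sum>v\<in>{v \<in> ?S. ?d v = k}. ?r)"
        using finite_dsphere[OF u] by (simp only: sum.inter_filter)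
      also have "\<dots> = str_const G v0 (?d u) n k"
        unfolding S by (simp add: str_const_eq_ratio[OF S1 S2 u n])
      finally show "Poly_Mapping.lookup (\<Sum>v\<in>?S. scale ?r (basis (?d v))) k =
          Poly_Mapping.lookup (graph_mul G v0 (basis (?d u)) (basis n)) k"
        by (simp add: graph_mul_basis)
    qed
    \<comment> \<open>The induction hypothesis is used with denominator \<open>c * card ?S\<close>,
      which splits into the common factor $1/c$ and the weight \<open>?r\<close> of one
      jump.\<close>
    have "jump_from G v0 u (n # ks) c =
        (\<Sum>v\<in>?S. scale (1 / of_nat c) (scale ?r (graph_mul G v0 (basis (?d v)) (basis_prod ks))))"
      unfolding jump_from.simps
      by (intro sum.cong refl) (simp only: Cons.IH[OF V ks] scale_scale of_nat_mult
          times_divide_times_eq mult_1)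
    \<comment> \<open>Linearity in the left factor collects the weighted sum over the sphere there,
      ready for \<open>step\<close>.\<close>
    also have "\<dots> = scale (1 / of_nat c)
        (\<Sum>v\<in>?S. graph_mul G v0 (scale ?r (basis (?d v))) (basis_prod ks))"
      unfolding scale_sum by (intro sum.cong refl) (simp only: mul_scale_left[OF b[OF V] Q])
    also have "\<dots> = scale (1 / of_nat c)
        (graph_mul G v0 (\<Sum>v\<in>?S. scale ?r (basis (?d v))) (basis_prod ks))"
      by (rule arg_cong[OF mul_sum_left[OF Q, symmetric]]) (rule scale_in_free_vs[OF b[OF V]])
    also have "\<dots> = scale (1 / of_nat c) (graph_mul G v0 (basis (?d u)) (basis_prod (n # ks)))"
      unfolding step basis_prod_Cons mul_assoc[OF b[OF u] basis_in_free_vs[OF n] Q] ..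
    finally show ?case .
  qed
qed

end

theorem corollary5p7:
  fixes G :: "'a pair_pre_digraph" and v0 :: 'a and m i j :: nat and ks :: "nat list"
  assumes "pointed_graph G v0"
    and "produces_hypergroup G v0"
    and S1: "\<forall>n\<in>levels G v0. \<forall>u\<in>pverts G. \<forall>v\<in>pverts G.
      card (dsphere G n u) = card (dsphere G n v)"
    and S2: "\<forall>a\<in>levels G v0. \<forall>b\<in>levels G v0. \<forall>c\<in>levels G v0.
      \<forall>u\<in>dsphere G c v0. \<forall>v\<in>dsphere G c v0.
      card (dsphere G a u \<inter> dsphere G b v0) = card (dsphere G a v \<inter> dsphere G b v0)"
    and "m \<ge> 1" and "length ks = m" and "set ks \<subseteq> levels G v0"
    and "i \<in> levels G v0" and "j \<in> levels G v0"
  shows "mat_prod (levels G v0) (map (trans_mat G v0) ks) i j =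
    sum' (\<lambda>k. jump_coeff G v0 ks k * str_const G v0 k i j) (levels G v0)"
proof -
  interpret pointed_graph G v0 by (rule assms(1))
  interpret hermitian_discrete_hypergroup "levels G v0" 0 "graph_mul G v0" "\<lambda>i. i"
    using assms(2) unfolding produces_hypergroup_def .
  let ?I = "levels G v0"
  note ks = \<open>set ks \<subseteq> ?I\<close> and i = \<open>i \<in> ?I\<close>
  obtain k ks' where k: "ks = k # ks'" using assms(5,6) by (cases ks) auto
  have bi: "basis i \<in> free_vs ?I" using i by (rule basis_in_free_vs)
  note Q = basis_prod_closed[OF ks]
  \<comment> \<open>The walk starts at level 0 with denominator 1, so its left factor is the
    unit.\<close>
  have "jump G v0 ks = graph_mul G v0 (basis 0) (basis_prod ks)"
    using jump_from_eq[OF assms(2) S1 S2 base ks, of 1] walk_dist_eq_0[OF base base]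
    by (intro poly_mapping_eqI) (simp add: jump_def lookup_scale)
  then have J: "jump G v0 ks = basis_prod ks" unfolding unit_left[OF Q] .
  have "mat_prod ?I (map (trans_mat G v0) ks) i j =
      foldl (mat_mul ?I) (trans_mat G v0 k) (map (trans_mat G v0) ks') i j"
    by (simp add: k mat_prod_def)
  also have "\<dots> = Poly_Mapping.lookup
      (foldl (\<lambda>g k. graph_mul G v0 g (basis k)) (graph_mul G v0 (basis i) (basis k)) ks') j"
    using ks i k assms(2)
    by (intro foldl_mat_mul_row mul_closed bi)
       (auto simp: basis_in_free_vs graph_mul_basis trans_mat_def intro!: str_const_commute)
  also have "\<dots> = Poly_Mapping.lookup (graph_mul G v0 (basis i) (basis_prod ks)) j"
    using foldl_mul_basis[OF bi ks] by (simp add: k)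
  also have "\<dots> = sum' (\<lambda>l. Poly_Mapping.lookup (basis_prod ks) l * str_const G v0 i l j) ?I"
    by (rule lookup_graph_mul_basis_left[OF Q])
  \<comment> \<open>Commutativity once more, exchanging \<open>i\<close> and \<open>l\<close>; the
    latter ranges over levels only.\<close>
  also have "\<dots> = sum' (\<lambda>l. jump_coeff G v0 ks l * str_const G v0 l i j) ?I"
    by (rule sum.cong') (simp_all add: jump_coeff_def J str_const_commute[OF assms(2) i])
  finally show ?thesis .
qed

end
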